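(* Assume the following statement (the independent-set cover conjecture) holds: for every finite bipartite graph $H=(V_H,E_H)$, every integer $M\ge 1$ and every $M$-cover $\tilde H$ of $H$, one has $\Pi(p(\tilde H))\preceq p(H)^M$, i.e. every monomial coefficient of $\Pi(p(\tilde H))$ is at most the corresponding coefficient of $p(H)^M$; equivalently, for every $U\subset V_H$, the number of independent sets $I$ of $\tilde H$ with $\pi(I)=U$ is at most the number of independent sets $I$ of the trivial cover $H^{\oplus M}$ with $\pi(I)=U$. Then for every finite graph $G=(V,E)$ and every binary pairwise attractive model on $G$, i.e. every choice of real interactions $(\mathbf J,\mathbf h)=((J_{uv})_{uv\in E},(h_v)_{v\in V})$ with $J_{uv}\ge 0$ for all $uv\in E$, one has $$Z(G;\mathbf J,\mathbf h)\ \ge\ Z_B(G;\mathbf J,\mathbf h).$$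
   Context: Graphs are finite with undirected edges; $\vec E$ denotes the set of directed edges obtained by replacing each undirected edge $uv$ by the two directed edges $u\to v$, $v\to u$. For $M\ge1$, a permutation voltage assignment is a map $\alpha:\vec E\to\mathfrak S_M$ (the symmetric group on $\{1,\dots,M\}$) with $\alpha(u\to v)=\alpha(v\to u)^{-1}$ for all $uv\in E$. The associated $M$-cover $\tilde G=(\tilde V,\tilde E)$ has $\tilde V=V\times\{1,\dots,M\}$ and $(v,k)(u,l)\in\tilde E$ iff $uv\in E$ and $l=\alpha(v\to u)(k)$; every $M$-cover arises this way. The trivial $M$-cover $G^{\oplus M}$ (from identity permutations) is $M$ disjoint copies of $G$. The natural projection $\pi$ sends $(v,k)\mapsto v$ and $(v,k)(u,l)\mapsto vu$. An independent set of a graph is a vertex subset containing no two adjacent vertices. The multivariate independent set polynomial is $p(G)=\sum_{I\text{ independent}}\prod_{v\in I}x_v$ in indeterminates $x_v$ ($v\in V$). For a cover $\tilde G$ of $G$, $\Pi$ is the ring homomorphism from polynomials in $(x_{\tilde v})_{\tilde v\in\tilde V}$ to polynomials in $(x_v)_{v\in V}$ determined by $\Pi(x_{\tilde v})=x_{\pi(\tilde v)}$. The partition function of the binary pairwise model on $G$ is $Z(G;\mathbf J,\mathbf h)=\sum_{\mathbf s\in\{0,1\}^V}\exp\big(\sum_{uv\in E}J_{uv}s_us_v+\sum_{v\in V}h_vs_v\big)$. For a cover $\tilde G$, interactions are induced from $G$: $J_{(v,k)(u,l)}=J_{vu}$ and $h_{(v,k)}=h_v$, and $Z(\tilde G)$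 denotes the corresponding partition function. The Bethe partition function is $Z_B=\exp(-\min_q F_B(q))$, where $F_B$ is the Bethe free energy of the model; it is characterized (Vontobel) by $Z_B=\limsup_{M\to\infty}\langle Z(\tilde G)\rangle^{1/M}$, where $\langle\cdot\rangle$ denotes the average over the $M!^{|E|}$ $M$-covers $\tilde G$ given by all permutation voltage assignments. *)

theory Defs
  imports "HOL-Analysis.Analysis" "HOL-Library.Poly_Mapping" "HOL-Real_Asymp.Real_Asymp"
begin

section \<open>Graphs, covers and independent sets\<close>

text \<open>Finite simple graphs; an undirected edge is the two-element set of its endpoints.\<close>

definition fin_graph :: "'v set \<Rightarrow> 'v set set \<Rightarrow> bool" where
  "fin_graph V E \<longleftrightarrow> finite V \<and> (\<forall>e\<in>E. e \<subseteq> V \<and> card e = 2)"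

definition bipartite :: "'v set \<Rightarrow> 'v set set \<Rightarrow> bool" where
  "bipartite V E \<longleftrightarrow>
     (\<exists>A B. A \<union> B = V \<and> A \<inter> B = {} \<and> (\<forall>e\<in>E. \<exists>a\<in>A. \<exists>b\<in>B. e = {a, b}))"

text \<open>
  \<open>\<alpha> u v\<close> is the permutation attached to the directed edge from \<open>u\<close> to \<open>v\<close>. The values of \<open>\<alpha>\<close>
  on pairs that are not edges are unconstrained and never used.
\<close>

definition voltage_assignment :: "'v set set \<Rightarrow> nat \<Rightarrow> ('v \<Rightarrow> 'v \<Rightarrow> nat \<Rightarrow> nat) \<Rightarrow> bool" where
  "voltage_assignment E M \<alpha> \<longleftrightarrow>
     (\<forall>u v. {u, v} \<in> E \<longrightarrow> \<alpha> u v permutes {1..M} \<and> \<alpha> u v = inv (\<alpha> v u))"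

definition cover_verts :: "'v set \<Rightarrow> nat \<Rightarrow> ('v \<times> nat) set" where
  "cover_verts V M = V \<times> {1..M}"

definition cover_edges ::
    "'v set set \<Rightarrow> nat \<Rightarrow> ('v \<Rightarrow> 'v \<Rightarrow> nat \<Rightarrow> nat) \<Rightarrow> ('v \<times> nat) set set" where
  "cover_edges E M \<alpha> =
     {{(v, k), (u, l)} | v k u l.
        {v, u} \<in> E \<and> k \<in> {1..M} \<and> l \<in> {1..M} \<and> l = \<alpha> v u k}"

definition indep_sets :: "'v set \<Rightarrow> 'v set set \<Rightarrow> 'v set set" where
  "indep_sets V E = {I. I \<subseteq> V \<and> (\<forall>u\<in>I. \<forall>v\<in>I. {u, v} \<notin> E)}"

lemma fin_graph_cover:
  assumes "fin_graph V E"
  shows "fin_graph (cover_verts V M) (cover_edges E M \<alpha>)"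
  unfolding fin_graph_def
proof (intro conjI ballI)
  show "finite (cover_verts V M)"
    using assms by (simp add: fin_graph_def cover_verts_def)
  fix e assume "e \<in> cover_edges E M \<alpha>"
  then obtain v k u l where e: "e = {(v, k), (u, l)}" "{v, u} \<in> E" "k \<in> {1..M}" "l \<in> {1..M}"
    unfolding cover_edges_def by blast
  have "{v, u} \<subseteq> V" "card {v, u} = 2"
    using assms e(2) by (simp_all only: fin_graph_def)
  moreover from this have "v \<noteq> u"
    by auto
  ultimately show "e \<subseteq> cover_verts V M" "card e = 2"
    using e by (simp_all add: cover_verts_def)
qed

section \<open>The independent set polynomial\<close>

text \<open>
  Multivariate integer polynomials are finitely supported maps from monomials to coefficients;
  a monomial is a finitely supported map from indeterminates to exponents.
\<close>

type_synonym 'v mpoly_int = "('v \<Rightarrow>\<^sub>0 nat) \<Rightarrow>\<^sub>0 int"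

definition X :: "'v \<Rightarrow> 'v mpoly_int" where
  "X v = Poly_Mapping.single (Poly_Mapping.single v 1) 1"

definition indep_poly :: "'v set \<Rightarrow> 'v set set \<Rightarrow> 'v mpoly_int" where
  "indep_poly V E = (\<Sum>I\<in>indep_sets V E. \<Prod>v\<in>I. X v)"

definition proj_poly :: "('v \<times> nat) mpoly_int \<Rightarrow> 'v mpoly_int" where
  "proj_poly p = (\<Sum>m\<in>Poly_Mapping.keys p. of_int (Poly_Mapping.lookup p m) *
     (\<Prod>w\<in>Poly_Mapping.keys m. X (fst w) ^ Poly_Mapping.lookup m w))"

definition coeff_le :: "'v mpoly_int \<Rightarrow> 'v mpoly_int \<Rightarrow> bool" (infix "\<preceq>" 50) where
  "p \<preceq> q \<longleftrightarrow> (\<forall>m. Poly_Mapping.lookup p m \<le> Poly_Mapping.lookup q m)"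

text \<open>
  The projection is the ring homomorphism determined by \<open>X (v, k) \<mapsto> X v\<close>:
\<close>

lemma proj_poly_zero: "proj_poly 0 = 0"
  by (simp add: proj_poly_def)

lemma proj_poly_superset:
  assumes "finite S" "Poly_Mapping.keys p \<subseteq> S"
  shows "proj_poly p = (\<Sum>m\<in>S. of_int (Poly_Mapping.lookup p m) *
     (\<Prod>w\<in>Poly_Mapping.keys m. X (fst w) ^ Poly_Mapping.lookup m w))"
  unfolding proj_poly_def
  by (rule sum.mono_neutral_left) (use assms in \<open>auto simp: in_keys_iff\<close>)

lemma proj_poly_add: "proj_poly (p + q) = proj_poly p + proj_poly q"
proof -
  let ?S = "Poly_Mapping.keys p \<union> Poly_Mapping.keys q"
  have "Poly_Mapping.keys (p + q) \<subseteq> ?S"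
    by (rule Poly_Mapping.keys_add)
  then show ?thesis
    by (simp add: proj_poly_superset[of ?S] lookup_add distrib_right sum.distrib)
qed

lemma proj_poly_single:
  "proj_poly (Poly_Mapping.single m c) =
     of_int c * (\<Prod>w\<in>Poly_Mapping.keys m. X (fst w) ^ Poly_Mapping.lookup m w)"
  by (cases "c = 0") (simp_all add: proj_poly_def)

lemma proj_poly_one: "proj_poly 1 = 1"
  using proj_poly_single[of 0 1] by simp

lemma proj_poly_X: "proj_poly (X w) = X (fst w)"
  by (simp add: X_def[of w] proj_poly_single)

lemma proj_poly_mult: "proj_poly (p * q) = proj_poly p * proj_poly q"
proof -
  have mon: "(\<Prod>w\<in>Poly_Mapping.keys (m + n). X (fst w) ^ Poly_Mapping.lookup (m + n) w) =
      (\<Prod>w\<in>Poly_Mapping.keys m. X (fst w) ^ Poly_Mapping.lookup m w) *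
      (\<Prod>w\<in>Poly_Mapping.keys n. X (fst w) ^ Poly_Mapping.lookup n w)"
    for m n :: "('v \<times> nat) \<Rightarrow>\<^sub>0 nat"
  proof -
    let ?S = "Poly_Mapping.keys m \<union> Poly_Mapping.keys n"
    have ext: "(\<Prod>w\<in>Poly_Mapping.keys k. X (fst w) ^ Poly_Mapping.lookup k w) =
        (\<Prod>w\<in>?S. X (fst w) ^ Poly_Mapping.lookup k w)"
      if "Poly_Mapping.keys k \<subseteq> ?S" for k :: "('v \<times> nat) \<Rightarrow>\<^sub>0 nat"
      by (rule prod.mono_neutral_left) (use that in \<open>auto simp: in_keys_iff\<close>)
    show ?thesis
      using ext[OF Poly_Mapping.keys_add] ext[of m] ext[of n]
      by (simp add: lookup_add power_add prod.distrib)
  qed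
  have single: "proj_poly (Poly_Mapping.single m c * Poly_Mapping.single n d) =
      proj_poly (Poly_Mapping.single m c) * proj_poly (Poly_Mapping.single n d)"
    for m n :: "('v \<times> nat) \<Rightarrow>\<^sub>0 nat" and c d
    by (simp add: mult_single proj_poly_single mon algebra_simps)
  have decomp: "r = (\<Sum>m\<in>Poly_Mapping.keys r. Poly_Mapping.single m (Poly_Mapping.lookup r m))"
    for r :: "('v \<times> nat) mpoly_int"
    by (rule poly_mapping_eqI)
      (simp add: lookup_sum lookup_single when_def sum.If_cases in_keys_iff if_distrib cong: if_cong)
  have psum: "proj_poly (sum f S) = (\<Sum>x\<in>S. proj_poly (f x))"
    for f :: "'b \<Rightarrow> ('v \<times> nat) mpoly_int" and S
    by (induction S rule: infinite_finite_induct) (simp_all add: proj_poly_zero proj_poly_add)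
  let ?s = "\<lambda>r m. Poly_Mapping.single m (Poly_Mapping.lookup r m) :: ('v \<times> nat) mpoly_int"
  have "proj_poly (p * q) =
      proj_poly (\<Sum>m\<in>Poly_Mapping.keys p. \<Sum>n\<in>Poly_Mapping.keys q. ?s p m * ?s q n)"
    by (subst decomp[of p], subst decomp[of q]) (simp only: sum_product)
  also have "\<dots> = proj_poly (\<Sum>m\<in>Poly_Mapping.keys p. ?s p m) *
      proj_poly (\<Sum>n\<in>Poly_Mapping.keys q. ?s q n)"
    by (simp only: psum single sum_product)
  finally show ?thesis
    using decomp[of p] decomp[of q] by simp
qed

text \<open>
  Every finite graph is isomorphic to one whose vertices are natural numbers, so quantifying over
  vertex type \<^typ>\<open>nat\<close> covers all finite bipartite graphs.
\<close>

definition indep_set_cover_conjecture :: bool where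
  "indep_set_cover_conjecture \<longleftrightarrow>
     (\<forall>(V :: nat set) E M \<alpha>. fin_graph V E \<longrightarrow> bipartite V E \<longrightarrow> 1 \<le> M \<longrightarrow>
        voltage_assignment E M \<alpha> \<longrightarrow>
        proj_poly (indep_poly (cover_verts V M) (cover_edges E M \<alpha>)) \<preceq> indep_poly V E ^ M)"

section \<open>The binary pairwise model\<close>

abbreviation spins :: "'v set \<Rightarrow> ('v \<Rightarrow> nat) set" where
  "spins A \<equiv> A \<rightarrow>\<^sub>E {0, 1}"

definition partition_fun ::
    "'v set \<Rightarrow> 'v set set \<Rightarrow> ('v set \<Rightarrow> real) \<Rightarrow> ('v \<Rightarrow> real) \<Rightarrow> real" where
  "partition_fun V E J h =
     (\<Sum>s\<in>spins V. exp ((\<Sum>e\<in>E. J e * (\<Prod>v\<in>e. real (s v))) + (\<Sum>v\<in>V. h v * real (s v))))"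

text \<open>
  Pseudomarginals \<open>(b, c)\<close>: \<open>b v s\<close> is the belief that \<open>v\<close> has spin \<open>s\<close>, and \<open>c e x\<close> the belief
  that the two endpoints of \<open>e\<close> have the joint spins \<open>x \<in> spins e\<close>. Other arguments are irrelevant.
\<close>

definition local_polytope ::
    "'v set \<Rightarrow> 'v set set \<Rightarrow> (('v \<Rightarrow> nat \<Rightarrow> real) \<times> ('v set \<Rightarrow> ('v \<Rightarrow> nat) \<Rightarrow> real)) set" where
  "local_polytope V E = {(b, c).
     (\<forall>v\<in>V. (\<forall>s\<in>{0, 1}. 0 \<le> b v s) \<and> (\<Sum>s\<in>{0, 1}. b v s) = 1) \<and>
     (\<forall>e\<in>E. (\<forall>x\<in>spins e. 0 \<le> c e x) \<and> (\<Sum>x\<in>spins e. c e x) = 1 \<and>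
       (\<forall>v\<in>e. \<forall>s\<in>{0, 1}. (\<Sum>x\<in>{x \<in> spins e. x v = s}. c e x) = b v s))}"

text \<open>
  Average energy minus Bethe entropy; \<open>0 * ln 0 = 0\<close> is the usual convention.
\<close>

definition bethe_free_energy ::
    "'v set \<Rightarrow> 'v set set \<Rightarrow> ('v set \<Rightarrow> real) \<Rightarrow> ('v \<Rightarrow> real) \<Rightarrow>
     ('v \<Rightarrow> nat \<Rightarrow> real) \<times> ('v set \<Rightarrow> ('v \<Rightarrow> nat) \<Rightarrow> real) \<Rightarrow> real" where
  "bethe_free_energy V E J h = (\<lambda>(b, c).
     - (\<Sum>e\<in>E. \<Sum>x\<in>spins e. c e x * (J e * (\<Prod>v\<in>e. real (x v))))
     - (\<Sum>v\<in>V. \<Sum>s\<in>{0, 1}. b v s * (h v * real s))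
     + (\<Sum>e\<in>E. \<Sum>x\<in>spins e. c e x * ln (c e x))
     + (\<Sum>v\<in>V. (1 - real (card {e \<in> E. v \<in> e})) * (\<Sum>s\<in>{0, 1}. b v s * ln (b v s))))"

definition bethe_partition_fun ::
    "'v set \<Rightarrow> 'v set set \<Rightarrow> ('v set \<Rightarrow> real) \<Rightarrow> ('v \<Rightarrow> real) \<Rightarrow> real" where
  "bethe_partition_fun V E J h = exp (- (INF q\<in>local_polytope V E. bethe_free_energy V E J h q))"

text \<open>The infimum is attained, so it is the minimum of the Bethe free energy:\<close>

lemma continuous_on_x_ln_x: "continuous_on {0..} (\<lambda>x::real. x * ln x)"
proof (rule continuous_on_eq_continuous_within[THEN iffD2], rule ballI)
  fix x :: real assume "x \<in> {0..}"
  show "continuous (at x within {0..}) (\<lambda>x. x * ln x)"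
  proof (cases "x = 0")
    case True
    have "((\<lambda>x::real. x * ln x) \<longlongrightarrow> 0) (at_right 0)"
      by real_asymp
    moreover have "at (0::real) within {0..} = at_right 0"
      by (rule at_within_nhd[of _ UNIV]) auto
    ultimately show ?thesis
      using True by (simp add: continuous_within)
  next
    case False
    then show ?thesis
      by (intro continuous_intros) simp_all
  qed
qed

lemma local_polytope_nonempty:
  assumes "fin_graph V E"
  shows "local_polytope V E \<noteq> {}"
proof -
  have edge: "card (spins e) = 4 \<and> (\<forall>v\<in>e. \<forall>s\<in>{0, 1}. card {x \<in> spins e. x v = s} = 2)"
    if "e \<in> E" for e
  proof -
    have c2: "card e = 2" and fin: "finite e"
      using assms that by (auto simp: fin_graph_def intro: finite_subset)
    have "card {x \<in> spins e. x v = s} = 2" if v: "v \<in> e" and s: "s \<in> {0, 1}" for v s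
    proof -
      have "{x \<in> spins e. x v = s} = (\<Pi>\<^sub>E w\<in>e. if w = v then {s} else {0, 1})"
      proof (rule set_eqI)
        fix x
        have "(\<forall>w\<in>e. x w \<in> {0, 1}) \<and> x v = s \<longleftrightarrow>
            (\<forall>w\<in>e. x w \<in> (if w = v then {s} else {0, 1}))"
          using v s by (metis singleton_iff)
        then show "x \<in> {x \<in> spins e. x v = s} \<longleftrightarrow>
            x \<in> (\<Pi>\<^sub>E w\<in>e. if w = v then {s} else {0, 1})"
          unfolding mem_Collect_eq PiE_iff by blast
      qed
      then have "card {x \<in> spins e. x v = s} = (\<Prod>w\<in>e. if w = v then 1 else 2)"
        using fin by (simp add: card_PiE if_distrib numeral_2_eq_2 cong: if_cong)
      also have "\<dots> = 2"
        using fin v c2 by (simp add: prod.remove[of e v] card_Diff_singleton)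
      finally show ?thesis .
    qed
    then show ?thesis
      using c2 fin by (simp add: card_PiE power2_eq_square)
  qed
  have "(\<lambda>_ _. 1/2, \<lambda>_ _. 1/4) \<in> local_polytope V E"
    using edge by (auto simp: local_polytope_def)
  then show ?thesis
    by blast
qed

lemma bethe_min_attained:
  assumes "fin_graph V E"
  shows "\<exists>q\<in>local_polytope V E. \<forall>q'\<in>local_polytope V E.
    bethe_free_energy V E J h q \<le> bethe_free_energy V E J h q'"
proof -
  define P where "P = local_polytope V E"
  define F where "F = bethe_free_energy V E J h"
  define B where "B = (UNIV \<rightarrow>\<^sub>E (UNIV \<rightarrow>\<^sub>E {0..1}) :: ('a \<Rightarrow> nat \<Rightarrow> real) set)"
  define C where "C = (UNIV \<rightarrow>\<^sub>E (UNIV \<rightarrow>\<^sub>E {0..1}) :: ('a set \<Rightarrow> ('a \<Rightarrow> nat) \<Rightarrow> real) set)"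
  have fin: "finite E" "finite V" "\<And>e. e \<in> E \<Longrightarrow> finite e"
    using assms by (auto simp: fin_graph_def intro: finite_subset[of E "Pow V"] finite_subset[of _ V])
  have cpt: "compact (UNIV \<rightarrow>\<^sub>E S :: ('x \<Rightarrow> 'y::topological_space) set)" if "compact S" for S
    using that compactin_PiE[of "\<lambda>_::'x. euclidean :: 'y topology" UNIV "\<lambda>_. S"]
    by (simp add: euclidean_product_topology flip: compactin_euclidean_iff)
  have "compact (B \<times> C)"
    unfolding B_def C_def by (intro compact_Times cpt compact_Icc)
  have ev1: "continuous_on S (\<lambda>q. fst q v s)" 
    for S :: "(('a \<Rightarrow> nat \<Rightarrow> real) \<times> ('a set \<Rightarrow> ('a \<Rightarrow> nat) \<Rightarrow> real)) set" and v s
    by (intro continuous_on_product_then_coordinatewise[of S "\<lambda>q. fst q v"]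
        continuous_on_product_then_coordinatewise[of S fst] continuous_intros)
  have ev2: "continuous_on S (\<lambda>q. snd q e x)" 
    for S :: "(('a \<Rightarrow> nat \<Rightarrow> real) \<times> ('a set \<Rightarrow> ('a \<Rightarrow> nat) \<Rightarrow> real)) set" and e x
    by (intro continuous_on_product_then_coordinatewise[of S "\<lambda>q. snd q e"]
        continuous_on_product_then_coordinatewise[of S snd] continuous_intros)
  have "closed P"
    unfolding P_def local_polytope_def case_prod_unfold Ball_def
    by (intro closed_Collect_conj closed_Collect_all closed_Collect_imp open_Collect_const
        closed_Collect_le closed_Collect_eq continuous_on_sum continuous_on_const ev1 ev2)
  then have cK: "compact (P \<inter> (B \<times> C))"
    using \<open>compact (B \<times> C)\<close> by (simp add: closed_Int_compact)
  have xlx: "continuous_on (B \<times> C) (\<lambda>q. f q * ln (f q))"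
    if "continuous_on (B \<times> C) f" "\<And>q. q \<in> B \<times> C \<Longrightarrow> 0 \<le> f q"
    for f :: "_ \<Rightarrow> real"
    by (rule continuous_on_compose2[OF continuous_on_x_ln_x that(1)]) (use that(2) in auto)
  have nn: "0 \<le> fst q v s" "0 \<le> snd q e x" if "q \<in> B \<times> C" for q v s e x
    using that by (auto simp: B_def C_def PiE_iff)
  have ent1: "continuous_on (B \<times> C) (\<lambda>q. fst q v s * ln (fst q v s))" for v s
    by (rule xlx[OF ev1 nn(1)])
  have ent2: "continuous_on (B \<times> C) (\<lambda>q. snd q e x * ln (snd q e x))" for e x
    by (rule xlx[OF ev2 nn(2)])
  have "continuous_on (B \<times> C) F"
    unfolding F_def bethe_free_energy_def case_prod_unfold
    apply (rule continuous_on_add)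
     apply (rule continuous_on_add)
      apply (intro continuous_on_diff continuous_on_minus continuous_on_sum continuous_on_mult
        continuous_on_const ev1 ev2)
     apply (rule continuous_on_sum)+
     apply (rule ent2)
    apply (rule continuous_on_sum)
    apply (rule continuous_on_mult)
     apply (rule continuous_on_const)
    apply (rule continuous_on_sum)
    apply (rule ent1)
    done
  then have cF: "continuous_on (P \<inter> (B \<times> C)) F"
    by (rule continuous_on_subset) simp
  have clip: "\<exists>q'\<in>P \<inter> (B \<times> C). F q' = F q" if "q \<in> P" for q
  proof -
    obtain b c where q: "q = (b, c)" by force
    define b' where "b' = (\<lambda>v s. if v \<in> V \<and> s \<in> {0, 1} then b v s else 0)"
    define c' where "c' = (\<lambda>e x. if e \<in> E \<and> x \<in> spins e then c e x else 0)"
    have sub: "v \<in> V" if "e \<in> E" "v \<in> e" for e v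
      using assms that by (auto simp: fin_graph_def)
    have bP: "\<And>v s. v \<in> V \<Longrightarrow> s \<in> {0, 1} \<Longrightarrow> 0 \<le> b v s"
        "\<And>v. v \<in> V \<Longrightarrow> (\<Sum>s\<in>{0, 1}. b v s) = 1"
      and cP: "\<And>e x. e \<in> E \<Longrightarrow> x \<in> spins e \<Longrightarrow> 0 \<le> c e x"
        "\<And>e. e \<in> E \<Longrightarrow> (\<Sum>x\<in>spins e. c e x) = 1"
        "\<And>e v s. e \<in> E \<Longrightarrow> v \<in> e \<Longrightarrow> s \<in> {0, 1} \<Longrightarrow>
          (\<Sum>x\<in>{x \<in> spins e. x v = s}. c e x) = b v s"
      using \<open>q \<in> P\<close> unfolding q P_def local_polytope_def by blast+
    have b'_eq: "b' v s = b v s" if "v \<in> V" "s \<in> {0, 1}" for v s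
      using that by (simp add: b'_def)
    have c'_eq: "c' e x = c e x" if "e \<in> E" "x \<in> spins e" for e x
      using that by (simp add: c'_def)
    have "b v s \<le> 1" if "v \<in> V" "s \<in> {0, 1}" for v s
      using bP(1)[of v 0] bP(1)[of v 1] bP(2)[of v] that by auto
    moreover have "c e x \<le> 1" if "e \<in> E" "x \<in> spins e" for e x
      using member_le_sum[of x "spins e" "c e"] cP(1,2)[of e] that fin(3)[of e]
      by (simp add: finite_PiE)
    ultimately have "(b', c') \<in> B \<times> C"
      using bP(1) cP(1) by (auto simp: B_def C_def b'_def c'_def)
    moreover have "(b', c') \<in> P"
      unfolding P_def local_polytope_def mem_Collect_eq prod.case
    proof (intro conjI ballI)
      fix v s assume "v \<in> V" "s \<in> {0, 1::nat}"
      then show "0 \<le> b' v s"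
        by (simp only: b'_eq bP)
    next
      fix v assume "v \<in> V"
      then have "(\<Sum>s\<in>{0, 1}. b' v s) = (\<Sum>s\<in>{0, 1}. b v s)"
        by (intro sum.cong refl b'_eq)
      then show "(\<Sum>s\<in>{0, 1}. b' v s) = 1"
        using bP(2) \<open>v \<in> V\<close> by simp
    next
      fix e x assume "e \<in> E" "x \<in> spins e"
      then show "0 \<le> c' e x"
        by (simp only: c'_eq cP)
    next
      fix e assume "e \<in> E"
      then have "(\<Sum>x\<in>spins e. c' e x) = (\<Sum>x\<in>spins e. c e x)"
        by (intro sum.cong refl c'_eq)
      then show "(\<Sum>x\<in>spins e. c' e x) = 1"
        using cP(2) \<open>e \<in> E\<close> by simp
    next
      fix e v s assume *: "e \<in> E" "v \<in> e" "s \<in> {0, 1::nat}"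
      then have "(\<Sum>x\<in>{x \<in> spins e. x v = s}. c' e x) = (\<Sum>x\<in>{x \<in> spins e. x v = s}. c e x)"
        by (intro sum.cong refl c'_eq) auto
      then show "(\<Sum>x\<in>{x \<in> spins e. x v = s}. c' e x) = b' v s"
        by (simp only: cP(3)[OF *] b'_eq[OF sub[OF *(1,2)] *(3)])
    qed
    moreover have "F (b', c') = F q"
    proof -
      have "(\<Sum>e\<in>E. \<Sum>x\<in>spins e. g e x (c' e x)) = (\<Sum>e\<in>E. \<Sum>x\<in>spins e. g e x (c e x))"
        for g :: "_ \<Rightarrow> _ \<Rightarrow> real \<Rightarrow> real"
        by (intro sum.cong refl) (simp only: c'_eq)
      note ce = this[of "\<lambda>e x t. t * (J e * (\<Prod>v\<in>e. real (x v)))"] this[of "\<lambda>_ _ t. t * ln t"]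
      have be: "(\<Sum>s\<in>{0, 1}. g s (b' v s)) = (\<Sum>s\<in>{0, 1}. g s (b v s))" if "v \<in> V"
        for v and g :: "_ \<Rightarrow> real \<Rightarrow> real"
        using that by (intro sum.cong refl) (simp only: b'_eq)
      have "(\<Sum>v\<in>V. \<Sum>s\<in>{0, 1}. b' v s * (h v * real s)) =
          (\<Sum>v\<in>V. \<Sum>s\<in>{0, 1}. b v s * (h v * real s))"
        by (intro sum.cong refl be[of _ "\<lambda>s t. t * (h _ * real s)"])
      moreover have
        "(\<Sum>v\<in>V. (1 - real (card {e \<in> E. v \<in> e})) * (\<Sum>s\<in>{0, 1}. b' v s * ln (b' v s))) =
         (\<Sum>v\<in>V. (1 - real (card {e \<in> E. v \<in> e})) * (\<Sum>s\<in>{0, 1}. b v s * ln (b v s)))"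
        by (intro sum.cong refl arg_cong2[where f = "(*)"] be[of _ "\<lambda>_ t. t * ln t"])
      ultimately show ?thesis
        unfolding F_def bethe_free_energy_def q prod.case by (simp only: ce)
    qed
    ultimately show ?thesis
      by blast
  qed
  have "P \<inter> (B \<times> C) \<noteq> {}"
    using local_polytope_nonempty[OF assms] clip unfolding P_def by blast
  from continuous_attains_inf[OF cK this cF]
  obtain q where "q \<in> P \<inter> (B \<times> C)" "\<forall>q'\<in>P \<inter> (B \<times> C). F q \<le> F q'"
    by blast
  then show ?thesis
    using clip unfolding P_def F_def by (metis IntD1)
qed

lemma bethe_partition_fun_min:
  assumes "fin_graph V E"
  obtains q where "q \<in> local_polytope V E"
    and "\<And>q'. q' \<in> local_polytope V E \<Longrightarrow> bethe_free_energy V E J h q \<le> bethe_free_energy V E J h q'"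
    and "bethe_partition_fun V E J h = exp (- bethe_free_energy V E J h q)"
proof -
  obtain q where q: "q \<in> local_polytope V E"
    "\<And>q'. q' \<in> local_polytope V E \<Longrightarrow> bethe_free_energy V E J h q \<le> bethe_free_energy V E J h q'"
    using bethe_min_attained[OF assms] by blast
  have "(INF q\<in>local_polytope V E. bethe_free_energy V E J h q) = bethe_free_energy V E J h q"
    using q by (intro cInf_eq_minimum) auto
  then show ?thesis
    using that q by (simp add: bethe_partition_fun_def)
qed

end

theory Submission
  imports Defs
begin

text \<open>
  Fix pseudomarginals \<open>(b, c)\<close>, put \<open>p\<^sub>v = b v 1\<close>, and let \<open>Z\<^sub>F(\<theta>)\<close> be the partition function with
  edge set \<open>F\<close> and external field \<open>\<theta>\<close>. By induction on \<open>F\<close>, for \<^emph>\<open>all\<close> fields \<open>\<theta>\<close>,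
  \<open>ln Z\<^sub>F(\<theta>) \<ge> \<Sum>\<^sub>v (H(p\<^sub>v) + p\<^sub>v \<theta>\<^sub>v) + \<Sum>\<^sub>e\<^sub>\<in>\<^sub>F (H(c\<^sub>e) + J\<^sub>e c\<^sub>e(1,1) - \<Sum>\<^sub>v\<^sub>\<in>\<^sub>e H(p\<^sub>v))\<close>,
  which for \<open>F = E\<close> and \<open>\<theta> = h\<close> is the claim. Adding an edge \<open>uv\<close> amounts to taking the product with
  a separate two-spin system, which obeys an analogous bound by the Gibbs variational principle, and
  then identifying its spins with those at \<open>u\<close> and \<open>v\<close>. Identifying two spins of mean \<open>p\<close> costs at
  most \<open>H(p)\<close>, provided that the \<open>2 \<times> 2\<close> matrix of their joint weights has nonnegative determinant;
  attractive weights are log-supermodular and marginalisation preserves this, so it always has.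
\<close>

section \<open>The Gibbs variational principle\<close>

text \<open>Weighting \<open>ln t \<le> t - 1\<close> at \<open>t = a i / (b i * sum a I)\<close> by
  \<open>b i\<close> and summing over \<open>I\<close> makes the right-hand side cancel. Indices
  with \<open>b i = 0\<close> contribute nothing on the left.\<close>

lemma gibbs_variational:
  fixes a b :: "'i \<Rightarrow> real"
  assumes "finite I" and a: "\<And>i. i \<in> I \<Longrightarrow> 0 < a i" and b: "\<And>i. i \<in> I \<Longrightarrow> 0 \<le> b i"
    and one: "sum b I = 1"
  shows "exp (\<Sum>i\<in>I. b i * (ln (a i) - ln (b i))) \<le> sum a I"
proof -
  have "I \<noteq> {}" using one by auto
  then have Z: "0 < sum a I" using assms(1) a by (intro sum_pos) auto
  have "b i * (ln (a i) - ln (b i)) - b i * ln (sum a I) \<le> a i / sum a I - b i" if i: "i \<in> I" for i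
  proof (cases "b i = 0")
    case True
    then show ?thesis using a[OF i] Z by simp
  next
    case False
    then have bi: "0 < b i" using b[OF i] by simp
    have "ln (a i / (b i * sum a I)) \<le> a i / (b i * sum a I) - 1"
      using bi a[OF i] Z by (intro ln_le_minus_one) simp
    then have "b i * ln (a i / (b i * sum a I)) \<le> b i * (a i / (b i * sum a I) - 1)"
      using bi by (intro mult_left_mono) auto
    also have "\<dots> = a i / sum a I - b i"
      using bi Z by (simp add: field_simps)
    also have "ln (a i / (b i * sum a I)) = ln (a i) - ln (b i) - ln (sum a I)"
      using bi Z a[OF i] by (simp add: ln_div ln_mult)
    finally show ?thesis by (simp add: algebra_simps)
  qed
  then have "(\<Sum>i\<in>I. b i * (ln (a i) - ln (b i)) - b i * ln (sum a I)) \<le> (\<Sum>i\<in>I. a i / sum a I - b i)"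
    by (rule sum_mono)
  also have "\<dots> = 0"
    using Z one by (simp add: sum_subtractf flip: sum_divide_distrib)
  finally have "(\<Sum>i\<in>I. b i * (ln (a i) - ln (b i))) \<le> ln (sum a I)"
    using one by (simp add: sum_subtractf flip: sum_distrib_right)
  then show ?thesis
    using Z by (metis exp_le_cancel_iff exp_ln)
qed

definition binary_entropy :: "real \<Rightarrow> real" where
  "binary_entropy p = - (p * ln p + (1 - p) * ln (1 - p))"

lemma binary_gibbs_variational:
  fixes \<alpha> \<delta> p :: real
  assumes "0 < \<alpha>" "0 < \<delta>" "0 \<le> p" "p \<le> 1"
  shows "exp ((1 - p) * ln \<alpha> + p * ln \<delta> + binary_entropy p) \<le> \<alpha> + \<delta>"
  using gibbs_variational[of UNIV "\<lambda>c. if c then \<delta> else \<alpha>" "\<lambda>c. if c then p else 1 - p"] assms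
  by (simp add: UNIV_bool binary_entropy_def algebra_simps)

section \<open>Identifying binary variables\<close>

text \<open>
  The infimum over \<open>x\<close> and \<open>y\<close> can be bounded explicitly: shifting \<open>x\<close> against \<open>y\<close> balances the two
  off-diagonal terms, whose geometric mean is at most that of \<open>\<alpha>\<close> and \<open>\<delta>\<close>, so the right-hand side
  becomes at most a perfect square.
\<close>

lemma identify_two_variables:
  fixes \<alpha> \<beta> \<gamma> \<delta> p C :: real
  assumes pos: "0 < \<alpha>" "0 < \<beta>" "0 < \<gamma>" "0 < \<delta>" and det: "\<beta> * \<gamma> \<le> \<alpha> * \<delta>"
    and p: "0 \<le> p" "p \<le> 1"
    and bound: "\<And>x y. exp (C + p * (x + y)) \<le> \<alpha> + \<beta> * exp x + \<gamma> * exp y + \<delta> * exp (x + y)"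
  shows "exp (C - binary_entropy p) \<le> \<alpha> + \<delta>"
proof -
  consider "p = 0" | "p = 1" | "0 < p" "p < 1" using p by linarith
  then show ?thesis
  proof cases
    case 1
    \<comment> \<open>The goal leaves a slack of \<open>\<delta>\<close>: at
      \<open>x = y = ln t\<close> the three excess terms are at most
      \<open>(\<beta> + \<gamma> + \<delta>) * t\<close>, which this \<open>t\<close> makes equal to
      \<open>\<delta>\<close>.\<close>
    define t where "t = \<delta> / (\<beta> + \<gamma> + \<delta>)"
    have t: "0 < t" "t \<le> 1" "(\<beta> + \<gamma> + \<delta>) * t = \<delta>" using pos by (auto simp: t_def)
    have "exp C \<le> \<alpha> + \<beta> * t + \<gamma> * t + \<delta> * (t * t)"
      using bound[of "ln t" "ln t"] 1 t by (simp add: exp_double power2_eq_square)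
    also have "t * t \<le> t" using t by (simp add: mult_le_cancel_left1)
    then have "\<alpha> + \<beta> * t + \<gamma> * t + \<delta> * (t * t) \<le> \<alpha> + (\<beta> + \<gamma> + \<delta>) * t"
      using pos by (simp add: algebra_simps)
    finally show ?thesis using 1 t by (simp add: binary_entropy_def)
  next
    case 2
    \<comment> \<open>Mirror image of \<open>p = 0\<close>: now \<open>x = y = - ln t\<close>, both
      sides are multiplied by \<open>t * t\<close>, and the slack is
      \<open>\<alpha>\<close>.\<close>
    define t where "t = \<alpha> / (\<beta> + \<gamma> + \<alpha>)"
    have t: "0 < t" "t \<le> 1" "(\<beta> + \<gamma> + \<alpha>) * t = \<alpha>" using pos by (auto simp: t_def)
    have e: "exp (- ln t) = 1 / t" using t by (simp add: exp_minus inverse_eq_divide)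
    have "exp C * (1 / t * (1 / t)) \<le> \<alpha> + \<beta> * (1 / t) + \<gamma> * (1 / t) + \<delta> * (1 / t * (1 / t))"
      using bound[of "- ln t" "- ln t"] by (simp only: 2 mult_1 exp_add e)
    then have "exp C \<le> (\<alpha> + \<beta> / t + \<gamma> / t + \<delta> / (t * t)) * (t * t)"
      using t by (simp add: pos_divide_le_eq)
    also have "\<dots> = \<alpha> * (t * t) + \<beta> * t + \<gamma> * t + \<delta>"
      using t by (simp add: field_simps)
    also have "t * t \<le> t" using t by (simp add: mult_le_cancel_left1)
    then have "\<alpha> * (t * t) + \<beta> * t + \<gamma> * t + \<delta> \<le> (\<beta> + \<gamma> + \<alpha>) * t + \<delta>"
      using pos by (simp add: algebra_simps)
    finally show ?thesis using 2 t by (simp add: binary_entropy_def)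
  next
    case 3
    \<comment> \<open>\<open>x + y = 2 * s\<close> is taken where \<open>(sqrt \<alpha> + exp s *
      sqrt \<delta>)^2 * exp (- 2 * p * s)\<close> is minimal, that is, where
      \<open>exp s * sqrt \<delta> / sqrt \<alpha> = p / (1 - p)\<close>. The difference
      \<open>x - y = 2 * r\<close> equalises the off-diagonal terms.\<close>
    define s where "s = ln p - ln (1 - p) + (ln \<alpha> - ln \<delta>) / 2"
    define r where "r = (ln \<gamma> - ln \<beta>) / 2"
    have e: "\<beta> * exp (s + r) = exp (s + (ln \<beta> + ln \<gamma>) / 2)"
      "\<gamma> * exp (s - r) = exp (s + (ln \<beta> + ln \<gamma>) / 2)"
    proof -
      have "\<beta> * exp (s + r) = exp (ln \<beta> + (s + r))" "\<gamma> * exp (s - r) = exp (ln \<gamma> + (s - r))"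
        using pos by (simp_all add: exp_add)
      then show "\<beta> * exp (s + r) = exp (s + (ln \<beta> + ln \<gamma>) / 2)"
        "\<gamma> * exp (s - r) = exp (s + (ln \<beta> + ln \<gamma>) / 2)"
        by (simp_all add: r_def field_simps)
    qed
    have "ln (\<beta> * \<gamma>) \<le> ln (\<alpha> * \<delta>)" using det pos by simp
    then have "ln \<beta> + ln \<gamma> \<le> ln \<alpha> + ln \<delta>" using pos by (simp add: ln_mult)
    then have m: "exp (s + (ln \<beta> + ln \<gamma>) / 2) \<le> exp (s + (ln \<alpha> + ln \<delta>) / 2)" by simp
    have E1: "exp (s + (ln \<alpha> + ln \<delta>) / 2) = \<alpha> * (p / (1 - p))"
    proof -
      have "s + (ln \<alpha> + ln \<delta>) / 2 = ln \<alpha> + (ln p - ln (1 - p))" by (simp add: s_def field_simps)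
      then show ?thesis using 3 pos by (simp add: exp_add exp_diff)
    qed
    have E2: "\<delta> * exp (2 * s) = \<alpha> * (p / (1 - p))\<^sup>2"
    proof -
      have "\<delta> * exp (2 * s) = exp (ln \<delta> + 2 * s)" using pos by (simp add: exp_add)
      also have "ln \<delta> + 2 * s = ln \<alpha> + 2 * (ln p - ln (1 - p))" by (simp add: s_def field_simps)
      also have "exp \<dots> = \<alpha> * (exp (ln p - ln (1 - p)))\<^sup>2" using pos by (simp only: exp_add exp_double exp_ln)
      finally show ?thesis using 3 by (simp add: exp_diff)
    qed
    have "exp (C + p * (2 * s)) \<le> \<alpha> + \<beta> * exp (s + r) + \<gamma> * exp (s - r) + \<delta> * exp (2 * s)"
      using bound[of "s + r" "s - r"] by simp
    also have "\<dots> \<le> \<alpha> + 2 * (\<alpha> * (p / (1 - p))) + \<alpha> * (p / (1 - p))\<^sup>2"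
      using m unfolding e E1 E2 by simp
    also have "\<dots> = \<alpha> * (1 + p / (1 - p))\<^sup>2" by (simp add: power2_eq_square algebra_simps)
    also have "1 + p / (1 - p) = 1 / (1 - p)" using 3 by (simp add: field_simps)
    also have "\<alpha> * (1 / (1 - p))\<^sup>2 = exp (ln \<alpha> - 2 * ln (1 - p))"
      using pos 3 by (simp add: exp_diff exp_double power_divide)
    finally have "C + p * (2 * s) \<le> ln \<alpha> - 2 * ln (1 - p)" by simp
    moreover have "p * (2 * s) = p * (2 * ln p - 2 * ln (1 - p) + ln \<alpha> - ln \<delta>)"
      by (simp add: s_def field_simps)
    \<comment> \<open>The minimum carries the entropy twice: one copy pays for the identification,
      the other completes the variational bound for two states of weights \<open>\<alpha>\<close>
      and \<open>\<delta>\<close>.\<close>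
    ultimately have "C - binary_entropy p \<le> (1 - p) * ln \<alpha> + p * ln \<delta> + binary_entropy p"
      by (simp add: binary_entropy_def algebra_simps)
    then show ?thesis
      using binary_gibbs_variational[OF pos(1,4) p] by (meson exp_le_cancel_iff order_trans)
  qed
qed

text \<open>
  Two identifications: after the first one the pair of remaining variables is described by a product
  of two matrices of nonnegative determinant, so the second one is admissible as well.
\<close>

lemma glue_pair_interactions:
  fixes p q A B :: real
  assumes G: "0 < g00" "0 < g01" "0 < g10" "0 < g11" "g01 * g10 \<le> g00 * g11"
    and K: "0 < k00" "0 < k01" "0 < k10" "0 < k11" "k01 * k10 \<le> k00 * k11"
    and p: "0 \<le> p" "p \<le> 1" and q: "0 \<le> q" "q \<le> 1"
    and gb: "\<And>x y. exp (A + p * x + q * y) \<le> g00 + g10 * exp x + g01 * exp y + g11 * exp (x + y)"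
    and kb: "\<And>x y. exp (B + p * x + q * y) \<le> k00 + k10 * exp x + k01 * exp y + k11 * exp (x + y)"
  shows "exp (A + B - binary_entropy p - binary_entropy q)
    \<le> g00 * k00 + g10 * k10 + g01 * k01 + g11 * k11"
proof -
  \<comment> \<open>First identification, of the spins of mean \<open>p\<close>. The fields
    \<open>y\<close> and \<open>z\<close> on the other two spins stay free, so this is the premise
    of the second one.\<close>
  have step: "exp (A + B - binary_entropy p + q * (y + z))
    \<le> (g00 * k00 + g10 * k10) + (g01 * k00 + g11 * k10) * exp y
      + (g00 * k01 + g10 * k11) * exp z + (g01 * k01 + g11 * k11) * exp (y + z)" for y z
  proof -
    define g0 where "g0 = g00 + g01 * exp y"
    define g1 where "g1 = g10 + g11 * exp y"
    define k0 where "k0 = k00 + k01 * exp z"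
    define k1 where "k1 = k10 + k11 * exp z"
    have pos: "0 < g0" "0 < g1" "0 < k0" "0 < k1"
      using G K by (auto simp: g0_def g1_def k0_def k1_def intro!: add_pos_pos)
    have "exp ((A + B + q * (y + z)) - binary_entropy p) \<le> g0 * k0 + g1 * k1"
    \<comment> \<open>The two systems are still independent, so the matrix of joint weights has rank
      one and the determinant condition holds with equality.\<close>
    proof (rule identify_two_variables[where \<beta> = "g1 * k0" and \<gamma> = "g0 * k1"])
      fix x w
      have "exp (A + B + q * (y + z) + p * (x + w)) = exp (A + p * x + q * y) * exp (B + p * w + q * z)"
        by (simp add: algebra_simps flip: exp_add)
      also have "\<dots> \<le> (g0 + g1 * exp x) * (k0 + k1 * exp w)"
      proof (rule mult_mono)
        show "exp (A + p * x + q * y) \<le> g0 + g1 * exp x"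
          using gb[of x y] by (simp add: g0_def g1_def exp_add algebra_simps)
        show "exp (B + p * w + q * z) \<le> k0 + k1 * exp w"
          using kb[of w z] by (simp add: k0_def k1_def exp_add algebra_simps)
      qed (use pos in simp_all)
      finally show "exp (A + B + q * (y + z) + p * (x + w))
        \<le> g0 * k0 + g1 * k0 * exp x + g0 * k1 * exp w + g1 * k1 * exp (x + w)"
        by (simp add: exp_add algebra_simps)
    qed (use pos p in simp_all)
    also have "g0 * k0 + g1 * k1 = (g00 * k00 + g10 * k10) + (g01 * k00 + g11 * k10) * exp y
      + (g00 * k01 + g10 * k11) * exp z + (g01 * k01 + g11 * k11) * exp (y + z)"
      by (simp add: g0_def g1_def k0_def k1_def exp_add algebra_simps)
    finally show ?thesis by (simp add: algebra_simps)
  qed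
  \<comment> \<open>By multiplicativity this is the determinant for the remaining pair.\<close>
  have "0 \<le> (g00 * g11 - g01 * g10) * (k00 * k11 - k01 * k10)"
    using G K by simp
  then have det: "(g01 * k00 + g11 * k10) * (g00 * k01 + g10 * k11)
    \<le> (g00 * k00 + g10 * k10) * (g01 * k01 + g11 * k11)"
    by (simp add: algebra_simps)
  have "exp ((A + B - binary_entropy p) - binary_entropy q)
    \<le> (g00 * k00 + g10 * k10) + (g01 * k01 + g11 * k11)"
    by (rule identify_two_variables[OF _ _ _ _ det q step]) (use G K in \<open>auto intro!: add_pos_pos\<close>)
  then show ?thesis by simp
qed

section \<open>Log-supermodular functions\<close>

text \<open>The FKG lattice condition, a set standing for the spins equal to 1. Strict positivity is
  built in because the four-term inequality cancels a factor and identification takes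
  logarithms.\<close>

definition log_supermodular_on :: "'a set \<Rightarrow> ('a set \<Rightarrow> real) \<Rightarrow> bool" where
  "log_supermodular_on W f \<longleftrightarrow>
     (\<forall>S\<subseteq>W. 0 < f S) \<and> (\<forall>S\<subseteq>W. \<forall>T\<subseteq>W. f S * f T \<le> f (S \<union> T) * f (S \<inter> T))"

lemma sum_Pow_insert:
  fixes f :: "'a set \<Rightarrow> 'b::comm_monoid_add"
  assumes "finite A" "a \<notin> A"
  shows "sum f (Pow (insert a A)) = (\<Sum>T\<in>Pow A. f T + f (insert a T))"
proof -
  have "inj_on (insert a) (Pow A)"
    using assms(2) by (intro inj_onI) (metis Pow_iff insert_ident subsetD)
  moreover have "Pow A \<inter> insert a ` Pow A = {}" using assms(2) by auto
  ultimately show ?thesis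
    using assms(1) by (simp add: Pow_insert sum.union_disjoint sum.reindex sum.distrib)
qed

text \<open>The one-element case of the Ahlswede-Daykin four functions theorem. With
  \<open>P = c' * d\<close>, the mixed products \<open>a * b'\<close> and \<open>a' * b\<close> are
  at most \<open>P\<close>, and their product is at most \<open>P * (c * d')\<close>; expanding
  \<open>0 \<le> (P - a * b') * (P - a' * b)\<close> bounds their sum by
  \<open>P + c * d'\<close>.\<close>

lemma four_term_inequality:
  fixes a a' b b' c c' d d' :: real
  assumes "0 < c'" "0 < d" "0 < a" "0 < a'" "0 < b" "0 < b'"
    and ab: "a * b \<le> c * d" and ab': "a * b' \<le> c' * d" and a'b: "a' * b \<le> c' * d"
    and a'b': "a' * b' \<le> c' * d'"
  shows "(a + a') * (b + b') \<le> (c + c') * (d + d')"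
proof -
  define P where "P = c' * d"
  have P: "0 < P" using assms by (simp add: P_def)
  have "(a * b') * (a' * b) = (a * b) * (a' * b')" by simp
  also have "\<dots> \<le> (c * d) * (c' * d')"
    using assms by (intro mult_mono[OF ab a'b'] order_trans[OF _ ab]) simp_all
  also have "\<dots> = P * (c * d')" by (simp add: P_def)
  finally have XY: "(a * b') * (a' * b) \<le> P * (c * d')" .
  have "0 \<le> (P - a * b') * (P - a' * b)" using ab' a'b by (simp add: P_def)
  then have "P * (a * b' + a' * b) \<le> P * (P + c * d')" using XY by (simp add: algebra_simps)
  then have "a * b' + a' * b \<le> P + c * d'" using P by simp
  then show ?thesis using ab a'b' by (simp add: P_def algebra_simps)
qed

text \<open>Elements of \<open>R\<close> are summed out one at a time, each by the four-term
  inequality for the values with and without that element.\<close>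

lemma log_supermodular_on_marginal:
  assumes "finite R" "W \<inter> R = {}" "log_supermodular_on (W \<union> R) f"
  shows "log_supermodular_on W (\<lambda>S. \<Sum>T\<in>Pow R. f (S \<union> T))"
  using assms
proof (induction R arbitrary: f rule: finite_induct)
  case empty
  then show ?case by simp
next
  case (insert w R)
  define g where "g S = f S + f (insert w S)" for S
  have pos: "0 < f S" if "S \<subseteq> W \<union> insert w R" for S
    using insert.prems that by (simp add: log_supermodular_on_def)
  have lsm: "f S * f T \<le> f (S \<union> T) * f (S \<inter> T)" if "S \<subseteq> W \<union> insert w R" "T \<subseteq> W \<union> insert w R" for S T
    using insert.prems that by (simp add: log_supermodular_on_def)
  have "g S * g T \<le> g (S \<union> T) * g (S \<inter> T)" if S: "S \<subseteq> W \<union> R" and T: "T \<subseteq> W \<union> R" for S T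
    unfolding g_def
  proof (rule four_term_inequality)
    have w: "w \<notin> S" "w \<notin> T" using S T insert by auto
    have eq: "S \<inter> insert w T = S \<inter> T" "insert w S \<inter> T = S \<inter> T" using w by auto
    show "f S * f T \<le> f (S \<union> T) * f (S \<inter> T)" using S T by (intro lsm) auto
    show "f S * f (insert w T) \<le> f (insert w (S \<union> T)) * f (S \<inter> T)"
      using lsm[of S "insert w T"] S T eq by auto
    show "f (insert w S) * f T \<le> f (insert w (S \<union> T)) * f (S \<inter> T)"
      using lsm[of "insert w S" T] S T eq by auto
    show "f (insert w S) * f (insert w T) \<le> f (insert w (S \<union> T)) * f (insert w (S \<inter> T))"
      using lsm[of "insert w S" "insert w T"] S T by auto
  qed (use S T in \<open>auto intro!: pos\<close>)
  moreover have "0 < g S" if "S \<subseteq> W \<union> R" for S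
    unfolding g_def using that by (intro add_pos_pos pos) auto
  ultimately have "log_supermodular_on (W \<union> R) g"
    by (simp add: log_supermodular_on_def)
  then have "log_supermodular_on W (\<lambda>S. \<Sum>T\<in>Pow R. g (S \<union> T))"
    using insert by auto
  moreover have "(\<Sum>T\<in>Pow R. g (S \<union> T)) = (\<Sum>T\<in>Pow (insert w R). f (S \<union> T))" for S
    using insert.hyps by (simp add: sum_Pow_insert g_def)
  ultimately show ?case by simp
qed

section \<open>The Bethe bound\<close>

definition subset_weight :: "('v set \<Rightarrow> real) \<Rightarrow> 'v set set \<Rightarrow> ('v \<Rightarrow> real) \<Rightarrow> 'v set \<Rightarrow> real" where
  "subset_weight J F \<theta> S = exp ((\<Sum>e\<in>F. if e \<subseteq> S then J e else 0) + (\<Sum>v\<in>S. \<theta> v))"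

text \<open>In the exponent the field part is modular and the indicator of
  \<open>e \<subseteq> S\<close> is supermodular in \<open>S\<close>; \<open>0 \<le> J e\<close>
  keeps the direction.\<close>

lemma log_supermodular_on_subset_weight:
  assumes "finite V" "\<And>e. e \<in> F \<Longrightarrow> 0 \<le> J e"
  shows "log_supermodular_on V (subset_weight J F \<theta>)"
  unfolding log_supermodular_on_def
proof (intro conjI allI impI)
  fix S T assume "S \<subseteq> V" "T \<subseteq> V"
  then have fin: "finite S" "finite T" using assms(1) finite_subset by blast+
  define j where "j S = (\<Sum>e\<in>F. if e \<subseteq> S then J e else 0)" for S
  have "j S + j T \<le> j (S \<union> T) + j (S \<inter> T)"
    unfolding j_def sum.distrib[symmetric]
    by (intro sum_mono) (use assms(2) in auto)
  moreover have "sum \<theta> (S \<union> T) + sum \<theta> (S \<inter> T) = sum \<theta> S + sum \<theta> T"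
    using fin by (rule sum.union_inter)
  ultimately show "subset_weight J F \<theta> S * subset_weight J F \<theta> T
      \<le> subset_weight J F \<theta> (S \<union> T) * subset_weight J F \<theta> (S \<inter> T)"
    unfolding subset_weight_def j_def[symmetric] exp_add[symmetric] exp_le_cancel_iff by linarith
qed (simp add: subset_weight_def)

lemma sum_spins_insert:
  fixes g :: "('v \<Rightarrow> nat) \<Rightarrow> 'b::comm_monoid_add"
  assumes "finite A" "a \<notin> A"
  shows "sum g (spins (insert a A)) = (\<Sum>x\<in>spins A. g (x(a := 0)) + g (x(a := 1)))"
proof -
  have "sum g (spins (insert a A)) = (\<Sum>(s, x)\<in>{0, 1} \<times> spins A. g (x(a := s)))"
    unfolding PiE_insert_eq
    by (subst sum.reindex[OF inj_combinator[OF assms(2)]]) (simp add: case_prod_unfold)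
  also have "\<dots> = (\<Sum>s\<in>{0, 1}. \<Sum>x\<in>spins A. g (x(a := s)))"
    using assms(1) by (simp add: sum.cartesian_product)
  finally show ?thesis by (simp add: sum.distrib)
qed

lemma sum_spins_eq_sum_Pow:
  fixes g :: "'v set \<Rightarrow> 'b::comm_monoid_add"
  shows "(\<Sum>s\<in>spins V. g {v \<in> V. s v = 1}) = sum g (Pow V)"
  by (rule sum.reindex_bij_witness[where j = "\<lambda>s. {v \<in> V. s v = 1}"
        and i = "\<lambda>S. restrict (\<lambda>v. if v \<in> S then 1 else 0) V"])
    (auto simp: fun_eq_iff PiE_iff extensional_def restrict_def)

lemma partition_fun_eq_sum_subset_weight:
  assumes "fin_graph V E"
  shows "partition_fun V E J h = (\<Sum>S\<in>Pow V. subset_weight J E h S)"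
proof -
  have "exp ((\<Sum>e\<in>E. J e * (\<Prod>v\<in>e. real (s v))) + (\<Sum>v\<in>V. h v * real (s v)))
      = subset_weight J E h {v \<in> V. s v = 1}" if s: "s \<in> spins V" for s
  proof -
    have s01: "s v = 0 \<or> s v = 1" if "v \<in> V" for v
      using s that by (auto simp: PiE_iff)
    have "J e * (\<Prod>v\<in>e. real (s v)) = (if e \<subseteq> {v \<in> V. s v = 1} then J e else 0)" if "e \<in> E" for e
    proof -
      have e: "e \<subseteq> V" "finite e"
        using assms that by (auto simp: fin_graph_def intro: finite_subset)
      show ?thesis
      proof (cases "e \<subseteq> {v \<in> V. s v = 1}")
        case True
        then have "(\<Prod>v\<in>e. real (s v)) = 1" by (intro prod.neutral) auto
        then show ?thesis using True by simp
      next
        case False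
        then obtain v where "v \<in> e" "s v = 0" using e s01 by blast
        then have "(\<Prod>v\<in>e. real (s v)) = 0" using e by (intro prod_zero) auto
        then show ?thesis using False by simp
      qed
    qed
    moreover have "(\<Sum>v\<in>V. h v * real (s v)) = (\<Sum>v\<in>{v \<in> V. s v = 1}. h v)"
    proof -
      have "(\<Sum>v\<in>V. h v * real (s v)) = (\<Sum>v\<in>V. if s v = 1 then h v else 0)"
        using s01 by (intro sum.cong) fastforce+
      then show ?thesis
        using assms by (simp add: sum.inter_filter fin_graph_def)
    qed
    ultimately show ?thesis by (simp add: subset_weight_def)
  qed
  then show ?thesis
    unfolding partition_fun_def sum_spins_eq_sum_Pow[symmetric] by (intro sum.cong) auto
qed

section \<open>The bound for a single edge\<close>

definition edge_term :: "('v set \<Rightarrow> real) \<Rightarrow> ('v set \<Rightarrow> ('v \<Rightarrow> nat) \<Rightarrow> real) \<Rightarrow> 'v set \<Rightarrow> real" where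
  "edge_term J c e = (\<Sum>x\<in>spins e. c e x * (J e * (\<Prod>v\<in>e. real (x v)))) - (\<Sum>x\<in>spins e. c e x * ln (c e x))"

text \<open>The Gibbs principle on the four states of the edge with trial distribution
  \<open>c {u, v}\<close>; the fields see only its marginals. The factors \<open>1\<close> display
  the weights in the form in which \<open>glue_pair_interactions\<close> takes its second
  system.\<close>

lemma edge_bound:
  fixes J :: "'v set \<Rightarrow> real"
  assumes "u \<noteq> v" and nonneg: "\<And>x. x \<in> spins {u, v} \<Longrightarrow> 0 \<le> c {u, v} x"
    and one: "(\<Sum>x\<in>spins {u, v}. c {u, v} x) = 1"
    and p: "(\<Sum>x\<in>{x \<in> spins {u, v}. x u = 1}. c {u, v} x) = p"
    and q: "(\<Sum>x\<in>{x \<in> spins {u, v}. x v = 1}. c {u, v} x) = q"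
  shows "exp (edge_term J c {u, v} + p * y + q * z)
    \<le> 1 + 1 * exp y + 1 * exp z + exp (J {u, v}) * exp (y + z)"
proof -
  let ?e = "{u, v}"
  define w where "w x = exp (J ?e * (\<Prod>v\<in>?e. real (x v)) + y * real (x u) + z * real (x v))" for x
  have fin: "finite (spins ?e)" by (simp add: finite_PiE)
  have filt: "(\<Sum>x\<in>spins ?e. c ?e x * real (x i)) = (\<Sum>x\<in>{x \<in> spins ?e. x i = 1}. c ?e x)"
    if "i \<in> ?e" for i
  proof -
    have "c ?e x * real (x i) = (if x i = 1 then c ?e x else 0)" if "x \<in> spins ?e" for x
    proof -
      have "x i \<in> {0, 1}" using that \<open>i \<in> ?e\<close> by (rule PiE_mem)
      then show ?thesis by auto
    qed
    then show ?thesis using fin by (simp add: sum.inter_filter cong: sum.cong)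
  qed
  have pq: "p = (\<Sum>x\<in>spins ?e. c ?e x * real (x u))" "q = (\<Sum>x\<in>spins ?e. c ?e x * real (x v))"
    using filt[of u] filt[of v] p q by simp_all
  have "edge_term J c ?e + p * y + q * z = (\<Sum>x\<in>spins ?e. c ?e x * (ln (w x) - ln (c ?e x)))"
    unfolding pq edge_term_def w_def sum_distrib_right ln_exp
    by (simp add: algebra_simps sum.distrib sum_subtractf)
  also have "exp \<dots> \<le> sum w (spins ?e)"
    by (rule gibbs_variational[OF fin _ nonneg one]) (simp_all add: w_def)
  also have "\<dots> = 1 + 1 * exp y + 1 * exp z + exp (J ?e) * exp (y + z)"
    using assms(1) by (simp add: sum_spins_insert[simplified] w_def exp_add)
  finally show ?thesis .
qed

section \<open>Induction over the edges\<close>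

lemma bethe_bound_no_edges:
  fixes p :: "'v \<Rightarrow> real"
  assumes "finite V" "\<And>v. v \<in> V \<Longrightarrow> 0 \<le> p v \<and> p v \<le> 1"
  shows "exp (\<Sum>v\<in>V. binary_entropy (p v) + p v * \<theta> v) \<le> (\<Sum>S\<in>Pow V. exp (sum \<theta> S))"
  using assms
proof (induction V rule: finite_induct)
  case empty
  then show ?case by simp
next
  case (insert a V)
  have "exp (binary_entropy (p a) + p a * \<theta> a) \<le> 1 + exp (\<theta> a)"
    using binary_gibbs_variational[of 1 "exp (\<theta> a)" "p a"] insert.prems by (simp add: add.commute)
  then have "exp (\<Sum>v\<in>insert a V. binary_entropy (p v) + p v * \<theta> v)
      \<le> (1 + exp (\<theta> a)) * (\<Sum>S\<in>Pow V. exp (sum \<theta> S))"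
    using insert unfolding sum.insert[OF insert.hyps] exp_add[of "binary_entropy (p a) + p a * \<theta> a"]
    by (intro mult_mono) auto
  also have "\<dots> = (\<Sum>S\<in>Pow V. exp (sum \<theta> S) + exp (sum \<theta> (insert a S)))"
    unfolding sum_distrib_left
  proof (intro sum.cong refl)
    fix S assume "S \<in> Pow V"
    then have "finite S" "a \<notin> S" using insert.hyps finite_subset by auto
    then show "(1 + exp (\<theta> a)) * exp (sum \<theta> S) = exp (sum \<theta> S) + exp (sum \<theta> (insert a S))"
      by (simp add: exp_add algebra_simps)
  qed
  also have "\<dots> = (\<Sum>S\<in>Pow (insert a V). exp (sum \<theta> S))"
    using insert.hyps by (simp add: sum_Pow_insert)
  finally show ?case .
qed

text \<open>Varying the arbitrary field of \<open>IH\<close> at \<open>u\<close> and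
  \<open>v\<close> supplies the whole family of inequalities that
  \<open>glue_pair_interactions\<close> asks of the old system.\<close>

lemma bethe_bound_insert_edge:
  fixes p :: "'v \<Rightarrow> real"
  assumes V: "finite V" "u \<in> V" "v \<in> V" "u \<noteq> v"
    and F: "finite F" "{u, v} \<notin> F" "\<And>e. e \<in> insert {u, v} F \<Longrightarrow> 0 \<le> J e"
    and p: "0 \<le> p u" "p u \<le> 1" "0 \<le> p v" "p v \<le> 1"
    and IH: "\<And>\<theta>. exp (A + (\<Sum>w\<in>V. p w * \<theta> w)) \<le> (\<Sum>S\<in>Pow V. subset_weight J F \<theta> S)"
    and edge: "\<And>y z. exp (B + p u * y + p v * z)
      \<le> 1 + 1 * exp y + 1 * exp z + exp (J {u, v}) * exp (y + z)"
  shows "exp (A + B - binary_entropy (p u) - binary_entropy (p v) + (\<Sum>w\<in>V. p w * \<theta> w))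
    \<le> (\<Sum>S\<in>Pow V. subset_weight J (insert {u, v} F) \<theta> S)"
proof -
  define R where "R = V - {u, v}"
  have R: "finite R" "u \<notin> R" "v \<notin> R" "V = insert u (insert v R)"
    using V by (auto simp: R_def)
  \<comment> \<open>The joint weights of the spins at \<open>u\<close> and \<open>v\<close> in the
    old system, all other spins summed out.\<close>
  define G where "G S = (\<Sum>T\<in>Pow R. subset_weight J F \<theta> (S \<union> T))" for S
  have split: "sum f (Pow V) = (\<Sum>T\<in>Pow R. f T) + (\<Sum>T\<in>Pow R. f (insert u T))
      + (\<Sum>T\<in>Pow R. f (insert v T)) + (\<Sum>T\<in>Pow R. f (insert u (insert v T)))"
    for f :: "'v set \<Rightarrow> real"
  proof -
    have "sum f (Pow V) = (\<Sum>T\<in>Pow (insert v R). f T + f (insert u T))"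
      unfolding R(4) by (rule sum_Pow_insert) (use R V(4) in auto)
    also have "\<dots> = (\<Sum>T\<in>Pow R. (f T + f (insert u T)) + (f (insert v T) + f (insert u (insert v T))))"
      using R(1,3) by (rule sum_Pow_insert)
    finally show ?thesis by (simp add: sum.distrib)
  qed
  have "{u, v} \<union> R = V" using R by auto
  then have "log_supermodular_on ({u, v} \<union> R) (subset_weight J F \<theta>)"
    using log_supermodular_on_subset_weight[OF V(1), of F J \<theta>] F(3) by simp
  then have lsm: "log_supermodular_on {u, v} G"
    unfolding G_def[abs_def] using R(1-3) by (intro log_supermodular_on_marginal) auto
  have G_pos: "0 < G {}" "0 < G {v}" "0 < G {u}" "0 < G {u, v}"
    using lsm by (simp_all add: log_supermodular_on_def)
  \<comment> \<open>The lattice condition at the two singletons is the determinant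
    condition.\<close>
  have "G {v} * G {u} \<le> G ({v} \<union> {u}) * G ({v} \<inter> {u})"
    using lsm unfolding log_supermodular_on_def by (metis insertCI singletonD subsetI)
  then have G_det: "G {v} * G {u} \<le> G {} * G {u, v}"
    using V(4) by (simp add: insert_commute mult.commute)
  have old: "exp (A + (\<Sum>w\<in>V. p w * \<theta> w) + p u * y + p v * z)
      \<le> G {} + G {u} * exp y + G {v} * exp z + G {u, v} * exp (y + z)" for y z
  proof -
    define \<mu> where "\<mu> = (\<lambda>w. \<theta> w + (if w = u then y else 0) + (if w = v then z else 0))"
    have sumT: "finite S \<Longrightarrow> sum \<mu> S = sum \<theta> S + (if u \<in> S then y else 0) + (if v \<in> S then z else 0)" for S
      by (simp add: \<mu>_def sum.distrib)
    have w: "subset_weight J F \<mu> S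
        = subset_weight J F \<theta> S * exp ((if u \<in> S then y else 0) + (if v \<in> S then z else 0))"
      if "finite S" for S
      using sumT[OF that] by (simp add: subset_weight_def add.assoc flip: exp_add)
    have finT: "finite T" "u \<notin> T" "v \<notin> T" if "T \<in> Pow R" for T
      using that R finite_subset by auto
    have "(\<Sum>w\<in>V. p w * \<mu> w) = (\<Sum>w\<in>V. p w * \<theta> w) + p u * y + p v * z"
      using V by (simp add: \<mu>_def algebra_simps sum.distrib if_distrib[of "(*) _"] cong: if_cong)
    then have "exp (A + (\<Sum>w\<in>V. p w * \<theta> w) + p u * y + p v * z) \<le> (\<Sum>S\<in>Pow V. subset_weight J F \<mu> S)"
      using IH[of \<mu>] by (simp add: add.assoc)
    also have "\<dots> = G {} + G {u} * exp y + G {v} * exp z + G {u, v} * exp (y + z)"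
      unfolding split G_def sum_distrib_right
      by (intro arg_cong2[where f = "(+)"] sum.cong refl) (use finT V(4) in \<open>auto simp: w\<close>)
    finally show ?thesis .
  qed
  have new: "subset_weight J (insert {u, v} F) \<theta> S
      = subset_weight J F \<theta> S * (if u \<in> S \<and> v \<in> S then exp (J {u, v}) else 1)" for S
    using F by (simp add: subset_weight_def exp_add algebra_simps)
  \<comment> \<open>The edge system has weights 1, 1, 1 and \<open>exp (J {u, v})\<close>, so its
    determinant condition is attractiveness of the edge.\<close>
  have "exp (A + (\<Sum>w\<in>V. p w * \<theta> w) + B - binary_entropy (p u) - binary_entropy (p v))
      \<le> G {} * 1 + G {u} * 1 + G {v} * 1 + G {u, v} * exp (J {u, v})"
    by (rule glue_pair_interactions[OF G_pos G_det _ _ _ _ _ p old edge]) (use F(3) in simp_all)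
  also have "\<dots> = (\<Sum>S\<in>Pow V. subset_weight J (insert {u, v} F) \<theta> S)"
    unfolding split new G_def sum_distrib_right
    by (intro arg_cong2[where f = "(+)"] sum.cong refl) (use R V(4) in auto)
  finally show ?thesis by (simp add: algebra_simps)
qed

lemma bethe_bound:
  assumes graph: "fin_graph V E" and J: "\<And>e. e \<in> E \<Longrightarrow> 0 \<le> J e"
    and bc: "(b, c) \<in> local_polytope V E"
  shows "exp ((\<Sum>v\<in>V. binary_entropy (b v 1)) + (\<Sum>e\<in>E. edge_term J c e - (\<Sum>v\<in>e. binary_entropy (b v 1)))
      + (\<Sum>v\<in>V. b v 1 * \<theta> v)) \<le> (\<Sum>S\<in>Pow V. subset_weight J E \<theta> S)"
proof -
  have finV: "finite V" and finE: "finite E"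
    using graph by (auto simp: fin_graph_def intro: finite_subset[of E "Pow V"])
  have b01: "0 \<le> b v 1" "b v 1 \<le> 1" if "v \<in> V" for v
    using bc that by (auto simp: local_polytope_def)
  \<comment> \<open>Beliefs and vertices stay fixed while the edges enter one by one; the field is
    generalised for the induction.\<close>
  have "exp ((\<Sum>v\<in>V. binary_entropy (b v 1)) + (\<Sum>e\<in>F. edge_term J c e - (\<Sum>v\<in>e. binary_entropy (b v 1)))
      + (\<Sum>v\<in>V. b v 1 * \<theta> v)) \<le> (\<Sum>S\<in>Pow V. subset_weight J F \<theta> S)"
    if "finite F" "F \<subseteq> E" for F \<theta>
    using that
  proof (induction F arbitrary: \<theta> rule: finite_induct)
    case empty
    then show ?case
      using bethe_bound_no_edges[OF finV, of "\<lambda>v. b v 1" \<theta>] b01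
      by (simp add: subset_weight_def sum.distrib)
  next
    case (insert e F)
    then have "e \<in> E" by simp
    then have "card e = 2" "e \<subseteq> V" using graph by (auto simp: fin_graph_def)
    then obtain u v where e: "e = {u, v}" "u \<noteq> v" "u \<in> V" "v \<in> V"
      by (auto simp: card_2_iff)
    have c: "\<And>x. x \<in> spins e \<Longrightarrow> 0 \<le> c e x" "(\<Sum>x\<in>spins e. c e x) = 1"
      "\<And>v. v \<in> e \<Longrightarrow> (\<Sum>x\<in>{x \<in> spins e. x v = 1}. c e x) = b v 1"
      using bc \<open>e \<in> E\<close> unfolding local_polytope_def by blast+
    have edge: "exp (edge_term J c e + b u 1 * y + b v 1 * z)
        \<le> 1 + 1 * exp y + 1 * exp z + exp (J e) * exp (y + z)" for y z
      unfolding e(1) by (rule edge_bound) (use e c in auto)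
    have "exp (((\<Sum>v\<in>V. binary_entropy (b v 1)) + (\<Sum>e\<in>F. edge_term J c e - (\<Sum>v\<in>e. binary_entropy (b v 1))))
      + edge_term J c e - binary_entropy (b u 1) - binary_entropy (b v 1) + (\<Sum>w\<in>V. b w 1 * \<theta> w))
      \<le> (\<Sum>S\<in>Pow V. subset_weight J (insert {u, v} F) \<theta> S)"
      by (rule bethe_bound_insert_edge[OF finV e(3,4,2), where p = "\<lambda>v. b v 1"])
        (use insert e b01 J edge in auto)
    then show ?case
      using insert.hyps e by (simp add: algebra_simps)
  qed
  then show ?thesis using finE by blast
qed

section \<open>Comparison with the Bethe free energy\<close>

text \<open>Double counting of incidences turns the coefficient \<open>1 - deg v\<close> of each
  vertex entropy into one entropy per vertex minus one per edge end.\<close>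

lemma bethe_free_energy_eq:
  assumes graph: "fin_graph V E" and bc: "(b, c) \<in> local_polytope V E"
  shows "- bethe_free_energy V E J h (b, c) = (\<Sum>v\<in>V. binary_entropy (b v 1))
    + (\<Sum>e\<in>E. edge_term J c e - (\<Sum>v\<in>e. binary_entropy (b v 1))) + (\<Sum>v\<in>V. b v 1 * h v)"
proof -
  have fin: "finite V" "finite E"
    using graph by (auto simp: fin_graph_def intro: finite_subset[of E "Pow V"])
  have b0: "b v 0 = 1 - b v 1" if "v \<in> V" for v
    using bc that by (auto simp: local_polytope_def)
  have "(\<Sum>e\<in>E. \<Sum>v\<in>e. binary_entropy (b v 1)) = (\<Sum>e\<in>E. \<Sum>v\<in>{v \<in> V. v \<in> e}. binary_entropy (b v 1))"
  proof (intro sum.cong refl)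
    fix e assume "e \<in> E"
    then show "e = {v \<in> V. v \<in> e}" using graph by (auto simp: fin_graph_def)
  qed
  also have "\<dots> = (\<Sum>v\<in>V. real (card {e \<in> E. v \<in> e}) * binary_entropy (b v 1))"
    using fin by (subst sum.swap_restrict) auto
  finally have deg: "(\<Sum>e\<in>E. \<Sum>v\<in>e. binary_entropy (b v 1))
    = (\<Sum>v\<in>V. real (card {e \<in> E. v \<in> e}) * binary_entropy (b v 1))" .
  have "(\<Sum>v\<in>V. (1 - real (card {e \<in> E. v \<in> e})) * (\<Sum>s\<in>{0, 1}. b v s * ln (b v s)))
    = (\<Sum>v\<in>V. (1 - real (card {e \<in> E. v \<in> e})) * (- binary_entropy (b v 1)))"
    using b0 by (intro sum.cong refl) (simp add: binary_entropy_def)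
  then show ?thesis
    using deg by (simp add: bethe_free_energy_def edge_term_def sum_subtractf sum_negf left_diff_distrib
        sum.distrib)
qed

theorem mainTheorem1:
  fixes V :: "'v set" and E :: "'v set set"
    and J :: "'v set \<Rightarrow> real" and h :: "'v \<Rightarrow> real"
  assumes "indep_set_cover_conjecture"
    and "fin_graph V E"
    and "\<forall>e\<in>E. 0 \<le> J e"
  shows "partition_fun V E J h \<ge> bethe_partition_fun V E J h"
proof -
  \<comment> \<open>The Bethe minimum is attained, so it suffices to apply the bound at a minimiser
    with field \<open>h\<close>.\<close>
  obtain q where q: "q \<in> local_polytope V E"
    "bethe_partition_fun V E J h = exp (- bethe_free_energy V E J h q)"
    using bethe_partition_fun_min[OF assms(2)] by metis
  obtain b c where "q = (b, c)" by force
  then show ?thesis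
    using q bethe_bound[OF assms(2), of J b c h] assms(3)
    by (simp add: bethe_free_energy_eq[OF assms(2)] partition_fun_eq_sum_subset_weight[OF assms(2)])
qed

end
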